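(* $A_2(7,4) \leq 388$.
   Context: For a prime power $q$ and the vector space $V=\mathbb{F}_q^n$, let $\mathcal{P}(V)$ be the set of all subspaces of $V$, equipped with the subspace metric $d_s(U,W)=\dim(U+W)-\dim(U\cap W)$. A subspace code is a subset $\mathcal{C}\subseteq\mathcal{P}(V)$; its minimum distance is $\min\{d_s(U,W): U,W\in\mathcal{C}, U\neq W\}$. $A_q(n,d)$ denotes the maximum cardinality of a subspace code in $\mathcal{P}(\mathbb{F}_q^n)$ with minimum distance at least $d$. *)

theory Defs
  imports "HOL-Analysis.Analysis" "HOL-Library.Z2" "HOL-Library.Extended_Nat"
begin

lemma UNIV_bit: "(UNIV :: bit set) = {0, 1}"
  by auto

instance bit :: finite
  by standard (subst UNIV_bit, intro finite.intros)

lemma CARD_bit: "CARD(bit) = 2"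
  unfolding card_2_iff using UNIV_bit zero_neq_one by blast

text \<open>A type \<open>'a :: {field, finite}\<close> stands for the finite field with \<open>CARD('a)\<close> elements, and
  \<open>'a ^ 'n\<close> for its \<open>CARD('n)\<close>-dimensional coordinate space.\<close>

definition subspace_dist :: "('a::field ^ 'n::finite) set \<Rightarrow> ('a ^ 'n) set \<Rightarrow> nat" where
  "subspace_dist U W = vec.dim {u + w |u w. u \<in> U \<and> w \<in> W} - vec.dim (U \<inter> W)"

text \<open>The subtraction of natural numbers above never truncates on subspaces.\<close>

lemma dim_Int_le_dim_sums:
  fixes U W :: "('a::field ^ 'n::finite) set"
  assumes "vec.subspace U" "vec.subspace W"
  shows "vec.dim (U \<inter> W) \<le> vec.dim {u + w |u w. u \<in> U \<and> w \<in> W}"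
proof (rule vec.dim_subset, rule subsetI)
  fix x assume "x \<in> U \<inter> W"
  then have "x = x + 0" "x \<in> U" "0 \<in> W"
    using assms by (auto simp: vec.subspace_0)
  then show "x \<in> {u + w |u w. u \<in> U \<and> w \<in> W}"
    by blast
qed

definition subspace_code :: "('a::field ^ 'n::finite) set set \<Rightarrow> bool" where
  "subspace_code C \<longleftrightarrow> C \<subseteq> {U. vec.subspace U}"

text \<open>Codes with at most one element have minimum distance \<open>\<infinity>\<close>, the infimum of the empty set.\<close>

definition min_distance :: "('a::field ^ 'n::finite) set set \<Rightarrow> enat" where
  "min_distance C = Inf {enat (subspace_dist U W) |U W. U \<in> C \<and> W \<in> C \<and> U \<noteq> W}"

text \<open>\<open>max_code_size TYPE('a) TYPE('n) d\<close> is $A_q(n,d)$ for \<open>q = CARD('a)\<close> and \<open>n = CARD('n)\<close>.\<close>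

definition max_code_size ::
    "'a::{field, finite} itself \<Rightarrow> 'n::finite itself \<Rightarrow> nat \<Rightarrow> nat" where
  "max_code_size _ _ d =
     Max {card C |C :: ('a ^ 'n) set set. subspace_code C \<and> enat d \<le> min_distance C}"

text \<open>The maximum is taken over a finite nonempty set, so \<open>Max\<close> is not underspecified here.\<close>

lemma max_code_size_le_iff:
  "max_code_size TYPE('a::{field, finite}) TYPE('n::finite) d \<le> m \<longleftrightarrow>
    (\<forall>C :: ('a ^ 'n) set set. subspace_code C \<and> enat d \<le> min_distance C \<longrightarrow> card C \<le> m)"
proof -
  let ?S = "{card C |C :: ('a ^ 'n) set set. subspace_code C \<and> enat d \<le> min_distance C}"
  have "?S \<subseteq> card ` (UNIV :: ('a ^ 'n) set set set)"
    by auto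
  then have "finite ?S"
    using finite_subset by fastforce
  moreover have "subspace_code ({} :: ('a ^ 'n) set set) \<and> enat d \<le> min_distance ({} :: ('a ^ 'n) set set)"
    by (simp add: subspace_code_def min_distance_def Inf_enat_def)
  then have "?S \<noteq> {}"
    by blast
  ultimately show ?thesis
    unfolding max_code_size_def by (subst Max_le_iff) auto
qed

end

(*
  The Delsarte-Lovasz semidefinite programming bound. For a word U, project its indicator on the
  nonzero vectors orthogonally to the constants, and its indicator on the pairs (v, w) spanning a
  line orthogonally to the functions of v, of w and of v + w alone; the Gram matrices of these
  functions depend only on dim U, dim W and dim (U \<inter> W). Combining them with weights depending on
  the dimension of the word yields a positive semidefinite kernel F with F(U, W) \<le> -1 whenever
  U and W have distance at least 4, and F(U, U) < 388. Summing F over all pairs from a code of size n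
  gives 0 \<le> n (388 - eps) - n (n - 1) with eps > 0, hence n < 389.
*)
theory Submission
  imports Defs
begin

section \<open>Cardinalities of subspaces\<close>

text \<open>Adjoining \<open>b\<close> outside the span of \<open>B\<close> multiplies the size by
  \<open>CARD('a)\<close>: every vector of the larger span is \<open>k *s b + x\<close> for exactly
  one scalar \<open>k\<close> and one \<open>x\<close> in the old span.\<close>

lemma card_span_independent:
  fixes B :: "('a::{field,finite} ^ 'n::finite) set"
  assumes "finite B" "vec.independent B"
  shows "card (vec.span B) = CARD('a) ^ card B"
  using assms
proof (induction B rule: finite_induct)
  case empty
  then show ?case by simp
next
  case (insert b B)
  then have ind: "vec.independent B" and b: "b \<notin> vec.span B"
    using vec.independent_insert[of b B] by (auto split: if_splits)
  let ?f = "\<lambda>(k, x). k *s b + x"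
  have "inj_on ?f (UNIV \<times> vec.span B)"
  proof (rule inj_onI, clarify)
    fix k k' x x'
    assume x: "x \<in> vec.span B" "x' \<in> vec.span B" and eq: "k *s b + x = k' *s b + x'"
    have "(k - k') *s b = x' - x"
      using eq by (simp add: vec.scale_left_diff_distrib algebra_simps)
    then have "(k - k') *s b \<in> vec.span B"
      using x by (simp add: vec.span_diff)
    \<comment> \<open>For distinct \<open>k\<close> and \<open>k'\<close> this rescaling would put
      \<open>b\<close> itself into the span.\<close>
    then have "inverse (k - k') *s ((k - k') *s b) \<in> vec.span B"
      by (rule vec.span_scale)
    then have "k = k'"
      using b by (cases "k = k'") (simp_all only: vec.scale_scale, simp)
    then show "k = k' \<and> x = x'"
      using eq by simp
  qed
  moreover have "?f ` (UNIV \<times> vec.span B) = vec.span (insert b B)"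
  proof (intro equalityI subsetI)
    fix y assume "y \<in> vec.span (insert b B)"
    then obtain k where "y - k *s b \<in> vec.span B"
      by (auto simp: vec.span_insert)
    then show "y \<in> ?f ` (UNIV \<times> vec.span B)"
      by (intro image_eqI[of _ _ "(k, y - k *s b)"]) auto
  next
    fix y assume "y \<in> ?f ` (UNIV \<times> vec.span B)"
    then obtain k x where "y = k *s b + x" "x \<in> vec.span B"
      by auto
    then have "y - k *s b \<in> vec.span B"
      by simp
    then show "y \<in> vec.span (insert b B)"
      by (auto simp: vec.span_insert)
  qed
  ultimately have "card (vec.span (insert b B)) = card (UNIV \<times> vec.span B :: ('a \<times> _) set)"
    by (metis card_image)
  then show ?case
    using insert ind by (simp add: card_cartesian_product)
qed

lemma card_subspace:
  fixes U :: "('a::{field,finite} ^ 'n::finite) set"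
  assumes "vec.subspace U"
  shows "card U = CARD('a) ^ vec.dim U"
proof -
  obtain B where B: "B \<subseteq> U" "vec.independent B" "U \<subseteq> vec.span B" "card B = vec.dim U"
    using vec.basis_exists by blast
  then have "vec.span B = U"
    using assms vec.span_minimal by blast
  then show ?thesis
    using card_span_independent[of B] B by (simp add: vec.finiteI_independent)
qed

section \<open>The point kernel and the line kernel\<close>

definition ind :: "'v set \<Rightarrow> 'v \<Rightarrow> real" where
  "ind U v = of_bool (v \<in> U)"

lemma ind_mult_self [simp]: "ind U v * ind U v = ind U v"
  by (simp add: ind_def)

lemma ind_mult_Int: "ind U v * ind W v = ind (U \<inter> W) v"
  by (simp add: ind_def)

text \<open>Over the field with two elements each nonzero vector is a point of projective space, so
  this counts the points of a subspace.\<close>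

definition npts :: "'v::zero set \<Rightarrow> real" where
  "npts U = real (card (U - {0}))"

lemma npts_subspace:
  fixes U :: "(bit ^ 'n::finite) set"
  assumes "vec.subspace U"
  shows "npts U = 2 ^ vec.dim U - 1"
proof -
  have "card U = 2 ^ vec.dim U" "0 \<in> U"
    using card_subspace[OF assms] assms by (simp_all add: CARD_bit vec.subspace_0)
  then show ?thesis
    by (simp add: npts_def card_Diff_singleton of_nat_diff)
qed

lemma sum_ind_nonzero:
  fixes U :: "'v::{finite,zero} set"
  shows "(\<Sum>v\<in>-{0}. ind U v) = npts U"
proof -
  have "-{0} \<inter> {v. v \<in> U} = U - {0}"
    by auto
  then show ?thesis
    by (simp add: npts_def ind_def of_bool_def sum.If_cases)
qed

lemma sum_ind_off:
  fixes U :: "'v::{finite,zero} set"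
  assumes "v \<noteq> 0"
  shows "(\<Sum>w\<in>-{0,v}. ind U w) = npts U - ind U v"
proof -
  have "-{0} = insert v (-{0,v})"
    using assms by auto
  then show ?thesis
    using sum_ind_nonzero[of U] by simp
qed

lemma card_nonzero: "real (card (-{0} :: 'v::{finite,zero} set)) = npts (UNIV :: 'v set)"
  by (simp add: npts_def Compl_eq_Diff_UNIV)

lemma card_off:
  assumes "v \<noteq> (0 :: 'v::{finite,zero})"
  shows "real (card (-{0,v})) = npts (UNIV :: 'v set) - 1"
  using sum_ind_off[OF assms, of UNIV] by (simp add: ind_def)

text \<open>Subtracting the mean over the nonzero vectors projects the indicator orthogonally to the
  constants.\<close>

definition pt_fun :: "'v::{finite,zero} set \<Rightarrow> 'v \<Rightarrow> real" where
  "pt_fun U v = ind U v - npts U / npts (UNIV :: 'v set)"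

lemma point_kernel:
  fixes U W :: "'v::{finite,zero} set"
  assumes "npts (UNIV :: 'v set) \<noteq> 0"
  shows "(\<Sum>v\<in>-{0}. pt_fun U v * pt_fun W v)
    = npts (U \<inter> W) - npts U * npts W / npts (UNIV :: 'v set)"
proof -
  let ?N = "npts (UNIV :: 'v set)"
  have "pt_fun U v * pt_fun W v = ind (U \<inter> W) v - npts W / ?N * ind U v
      - npts U / ?N * ind W v + npts U * npts W / ?N\<^sup>2" for v
    by (simp add: pt_fun_def ind_mult_Int[symmetric] algebra_simps power2_eq_square)
  then have "(\<Sum>v\<in>-{0}. pt_fun U v * pt_fun W v)
      = npts (U \<inter> W) - npts W / ?N * npts U - npts U / ?N * npts W + ?N * (npts U * npts W / ?N\<^sup>2)"
    by (simp add: sum.distrib sum_subtractf sum_ind_nonzero card_nonzero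
        flip: sum_distrib_left sum_divide_distrib)
  then show ?thesis
    using assms by (simp add: power2_eq_square mult.commute)
qed

section \<open>Binary vectors and ordered pairs spanning a line\<close>

lemma bit_vec_add_self [simp]: "v + v = (0 :: bit ^ 'n::finite)"
  by (simp add: vec_eq_iff)

lemma bit_vec_add_eq_0_iff [simp]: "v + w = 0 \<longleftrightarrow> v = (w :: bit ^ 'n::finite)"
  by (metis add_right_cancel bit_vec_add_self)

lemma bit_vec_add_add_self [simp]: "v + w + w = (v :: bit ^ 'n::finite)"
  by (simp add: add.assoc)

text \<open>A pair in \<open>frames\<close> spans a line; each line arises from six pairs.\<close>

definition frames :: "((bit ^ 'n::finite) \<times> (bit ^ 'n)) set" where
  "frames = (SIGMA v:-{0}. -{0,v})"

lemma sum_frames: "sum g frames = (\<Sum>v\<in>-{0}. \<Sum>w\<in>-{0,v}. g (v, w))"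
  unfolding frames_def by (subst sum.Sigma) auto

lemma sum_frames_swap: "(\<Sum>(v,w)\<in>frames. g v w) = (\<Sum>(v,w)\<in>frames. g w v)"
  by (rule sum.reindex_bij_witness[of _ prod.swap prod.swap]) (auto simp: frames_def)

lemma sum_frames_shift:
  "(\<Sum>(v,w)\<in>frames. g v w) = (\<Sum>(v,w)\<in>frames. g (v + w) (w :: bit ^ 'n::finite))"
  by (rule sum.reindex_bij_witness[of _ "\<lambda>(v,w). (v + w, w)" "\<lambda>(v,w). (v + w, w)"])
    (auto simp: frames_def)

text \<open>Swap and shift are bijections of \<open>frames\<close> that permute the three points
  \<open>v\<close>, \<open>w\<close>, \<open>v + w\<close> of the line. An invariant weight
  \<open>g\<close> therefore gives each of them the same total.\<close>

lemma sum_frames_invariant: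
  fixes g :: "bit ^ 'n::finite \<Rightarrow> bit ^ 'n \<Rightarrow> real"
  assumes swap: "\<And>v w. g w v = g v w" and shift: "\<And>v w. g (v + w) w = g v w"
  shows "(\<Sum>(v,w)\<in>frames. g v w * (f v + f w + f (v + w))) = 3 * (\<Sum>(v,w)\<in>frames. g v w * f v)"
proof -
  have "(\<Sum>(v,w)\<in>frames. g v w * f w) = (\<Sum>(v,w)\<in>frames. g v w * f v)"
    by (subst sum_frames_swap) (simp add: swap)
  moreover have "(\<Sum>(v,w)\<in>frames. g v w * f (v + w)) = (\<Sum>(v,w)\<in>frames. g v w * f v)"
    by (subst sum_frames_shift) (simp add: shift)
  ultimately show ?thesis
    by (simp add: distrib_left sum.distrib case_prod_unfold)
qed

text \<open>The value that cancels the coefficient of \<open>ind U v\<close> in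
  \<open>ln_fun_marginal\<close>.\<close>

definition ln_slope :: "(bit ^ 'n::finite) set \<Rightarrow> real" where
  "ln_slope U = (npts U - 1) / (npts (UNIV :: (bit ^ 'n) set) - 3)"

text \<open>The coefficients make all marginals of \<open>ln_fun U\<close> over the pairs containing a given vector
  vanish.\<close>

definition ln_fun :: "(bit ^ 'n::finite) set \<Rightarrow> bit ^ 'n \<Rightarrow> bit ^ 'n \<Rightarrow> real" where
  "ln_fun U v w = ind U v * ind U w - ln_slope U * (ind U v + ind U w + ind U (v + w))
    + 2 * ln_slope U * npts U / (npts (UNIV :: (bit ^ 'n) set) - 1)"

lemma subspace_add_cancel:
  fixes U :: "(bit ^ 'n::finite) set"
  assumes "vec.subspace U" "w \<in> U"
  shows "v + w \<in> U \<longleftrightarrow> v \<in> U"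
  using assms by (metis bit_vec_add_add_self vec.subspace_add)

lemma ind_mult_shift:
  fixes U :: "(bit ^ 'n::finite) set"
  assumes "vec.subspace U"
  shows "ind U (v + w) * ind U w = ind U v * ind U w"
  by (cases "w \<in> U") (simp_all add: ind_def subspace_add_cancel[OF assms])

lemma ln_fun_swap: "ln_fun U w v = ln_fun U v w"
  by (simp add: ln_fun_def algebra_simps)

lemma ln_fun_shift: "vec.subspace U \<Longrightarrow> ln_fun U (v + w) w = ln_fun U v w"
  unfolding ln_fun_def by (simp only: ind_mult_shift bit_vec_add_add_self) (simp add: add_ac)

lemma sum_ind_add_off:
  fixes U :: "(bit ^ 'n::finite) set"
  assumes "v \<noteq> 0"
  shows "(\<Sum>w\<in>-{0,v}. ind U (v + w)) = npts U - ind U v"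
proof -
  have "(\<Sum>w\<in>-{0,v}. ind U (v + w)) = (\<Sum>w\<in>-{0,v}. ind U w)"
    by (rule sum.reindex_bij_witness[of _ "(+) v" "(+) v"]) (auto simp flip: add.assoc)
  then show ?thesis
    using sum_ind_off[OF assms] by simp
qed

lemma ln_fun_marginal:
  fixes U :: "(bit ^ 'n::finite) set"
  assumes "v \<noteq> 0" and N: "npts (UNIV :: (bit ^ 'n) set) > 3"
  shows "(\<Sum>w\<in>-{0,v}. ln_fun U v w) = 0"
proof -
  let ?N = "npts (UNIV :: (bit ^ 'n) set)" and ?s = "ind U v" and ?m = "npts U" and ?a = "ln_slope U"
  have "(\<Sum>w\<in>-{0,v}. ln_fun U v w)
      = ?s * (?m - ?s) - ?a * ((?N - 1) * ?s + 2 * (?m - ?s)) + (?N - 1) * (2 * ?a * ?m / (?N - 1))"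
    using assms unfolding ln_fun_def
    by (simp add: sum.distrib sum_subtractf sum_ind_off sum_ind_add_off card_off flip: sum_distrib_left)
  also have "(?N - 1) * (2 * ?a * ?m / (?N - 1)) = 2 * ?a * ?m"
    using N by simp
  \<comment> \<open>Idempotence of \<open>?s\<close> makes everything proportional to
    \<open>?s\<close>; the added constant cancels the term free of \<open>?s\<close>.\<close>
  also have "?s * (?m - ?s) - ?a * ((?N - 1) * ?s + 2 * (?m - ?s)) + 2 * ?a * ?m
      = ?s * (?m - 1 - ?a * (?N - 3))"
    using ind_mult_self[of U v] by (simp add: algebra_simps)
  also have "\<dots> = 0"
    using N by (simp add: ln_slope_def)
  finally show ?thesis .
qed

text \<open>Once \<open>v\<close> is fixed in \<open>W\<close>, the second vector ranges over the
  other \<open>npts W - 1\<close> points of \<open>W\<close>.\<close>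

lemma sum_frames_subspace:
  fixes U W :: "(bit ^ 'n::finite) set"
  shows "(\<Sum>(v,w)\<in>frames. ind W v * ind W w * ind U v) = npts (U \<inter> W) * (npts W - 1)"
proof -
  have "(\<Sum>(v,w)\<in>frames. ind W v * ind W w * ind U v)
      = (\<Sum>v\<in>-{0}. (ind W v * ind U v) * (\<Sum>w\<in>-{0,v}. ind W w))"
    by (simp add: sum_frames sum_distrib_left mult_ac)
  also have "\<dots> = (\<Sum>v\<in>-{0}. ind (U \<inter> W) v * (npts W - 1))"
  proof (intro sum.cong refl)
    fix v :: "bit ^ 'n" assume "v \<in> -{0}"
    then have "(\<Sum>w\<in>-{0,v}. ind W w) = npts W - ind W v"
      by (simp add: sum_ind_off)
    then show "ind W v * ind U v * (\<Sum>w\<in>-{0,v}. ind W w) = ind (U \<inter> W) v * (npts W - 1)"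
      by (auto simp: ind_def)
  qed
  finally show ?thesis
    by (simp add: sum_ind_nonzero flip: sum_distrib_right)
qed

text \<open>Vanishing marginals make \<open>ln_fun U\<close> orthogonal to functions of a single
  point, so the corrections in \<open>ln_fun W\<close> drop out and only incidence counts
  remain.\<close>

lemma line_kernel:
  fixes U W :: "(bit ^ 'n::finite) set"
  assumes U: "vec.subspace U" and W: "vec.subspace W" and N: "npts (UNIV :: (bit ^ 'n) set) > 3"
  shows "(\<Sum>(v,w)\<in>frames. ln_fun U v w * ln_fun W v w)
    = npts (U \<inter> W) * (npts (U \<inter> W) - 1) - 3 * ln_slope U * (npts W - 1) * npts (U \<inter> W)
      + 2 * ln_slope U * npts U * npts W * (npts W - 1) / (npts (UNIV :: (bit ^ 'n) set) - 1)"
proof -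
  let ?N = "npts (UNIV :: (bit ^ 'n) set)"
  let ?b = "\<lambda>U :: (bit ^ 'n) set. 2 * ln_slope U * npts U / (?N - 1)"
  have marg: "(\<Sum>(v,w)\<in>frames. ln_fun U v w * f v) = 0" for f
    using N by (simp add: sum_frames ln_fun_marginal flip: sum_distrib_right)
  have "(\<Sum>(v,w)\<in>frames. ln_fun U v w * ln_fun W v w)
      = (\<Sum>(v,w)\<in>frames. ln_fun U v w * (ind W v * ind W w))
        - ln_slope W * (\<Sum>(v,w)\<in>frames. ln_fun U v w * (ind W v + ind W w + ind W (v + w)))
        + ?b W * (\<Sum>(v,w)\<in>frames. ln_fun U v w * 1)"
    by (simp add: ln_fun_def[of W] case_prod_unfold sum_distrib_left sum.distrib sum_subtractf
        sum_divide_distrib algebra_simps)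
  also have "\<dots> = (\<Sum>(v,w)\<in>frames. ln_fun U v w * (ind W v * ind W w))"
    using marg[of "\<lambda>_. 1"] marg[of "ind W"]
    by (simp add: sum_frames_invariant[of "ln_fun U" "ind W", OF ln_fun_swap ln_fun_shift[OF U]])
  \<comment> \<open>The factor \<open>ind UNIV v\<close> is constantly 1; it gives the sums the
    shape of \<open>sum_frames_subspace\<close>.\<close>
  also have "\<dots> = (\<Sum>(v,w)\<in>frames. ind (U \<inter> W) v * ind (U \<inter> W) w * ind UNIV v)
      - ln_slope U * (\<Sum>(v,w)\<in>frames. (ind W v * ind W w) * (ind U v + ind U w + ind U (v + w)))
      + ?b U * (\<Sum>(v,w)\<in>frames. ind W v * ind W w * ind UNIV v)"
    by (simp add: ln_fun_def[of U] case_prod_unfold sum_distrib_left sum.distrib sum_subtractf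
        sum_divide_distrib algebra_simps ind_mult_Int[symmetric]) (simp add: ind_def)
  also have "(\<Sum>(v,w)\<in>frames. (ind W v * ind W w) * (ind U v + ind U w + ind U (v + w)))
      = 3 * (npts (U \<inter> W) * (npts W - 1))"
    using sum_frames_subspace[of W U]
    by (subst sum_frames_invariant) (simp_all add: ind_mult_shift[OF W] Int_commute)
  also have "(\<Sum>(v,w)\<in>frames. ind (U \<inter> W) v * ind (U \<inter> W) w * ind UNIV v)
      = npts (U \<inter> W) * (npts (U \<inter> W) - 1)"
    using sum_frames_subspace[of "U \<inter> W" UNIV] by simp
  also have "(\<Sum>(v,w)\<in>frames. ind W v * ind W w * ind UNIV v) = npts W * (npts W - 1)"
    using sum_frames_subspace[of W UNIV] by simp
  finally show ?thesis
    by (simp add: mult_ac)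
qed

text \<open>Exchanging the sums yields a sum of squares over \<open>S\<close>, whatever the signs of
  the weights \<open>c\<close>.\<close>

lemma gram_nonneg:
  fixes h :: "'u \<Rightarrow> 's \<Rightarrow> real"
  shows "(\<Sum>U\<in>C. \<Sum>W\<in>C. c U * c W * (\<Sum>s\<in>S. h U s * h W s)) \<ge> 0"
proof -
  have "(\<Sum>U\<in>C. \<Sum>W\<in>C. c U * c W * (\<Sum>s\<in>S. h U s * h W s))
      = (\<Sum>U\<in>C. \<Sum>W\<in>C. \<Sum>s\<in>S. (c U * h U s) * (c W * h W s))"
    by (simp add: sum_distrib_left mult_ac)
  also have "\<dots> = (\<Sum>s\<in>S. \<Sum>U\<in>C. \<Sum>W\<in>C. (c U * h U s) * (c W * h W s))"
    by (subst sum.swap[of _ S]) (rule sum.swap)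
  also have "\<dots> = (\<Sum>s\<in>S. (\<Sum>U\<in>C. c U * h U s)\<^sup>2)"
    by (simp add: power2_eq_square sum_product)
  finally show ?thesis
    by (simp add: sum_nonneg)
qed

section \<open>The certificate\<close>

definition point_ker :: "nat \<Rightarrow> nat \<Rightarrow> nat \<Rightarrow> real" where
  "point_ker i j d = (2^d - 1) - (2^i - 1) * (2^j - 1) / 127"

text \<open>This is \<open>line_kernel\<close> with 127 points in the whole space: 124 is 127 - 3
  and 126 is 127 - 1.\<close>

definition line_ker :: "nat \<Rightarrow> nat \<Rightarrow> nat \<Rightarrow> real" where
  "line_ker i j d = (2^d - 1) * (2^d - 2) - 3 * (2^i - 2) * (2^j - 2) * (2^d - 1) / 124
    + 2 * (2^i - 1) * (2^i - 2) * (2^j - 1) * (2^j - 2) / (124 * 126)"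

lemma point_ker_sym: "point_ker i j d = point_ker j i d"
  by (simp add: point_ker_def)

lemma line_ker_sym: "line_ker i j d = line_ker j i d"
  by (simp add: line_ker_def) (simp add: algebra_simps)

text \<open>The weights, indexed by dimension, are a rounded numerical solution of the semidefinite
  program, scaled by \<open>1000\<close>.\<close>

definition const_wt :: "nat \<Rightarrow> real" where
  "const_wt i = [7045, 3607, 959, 143, -142, -995, -3795, -7063] ! i"
definition point_wt1 :: "nat \<Rightarrow> real" where
  "point_wt1 i = [0, 9604, 3100, 2627, 1863, 1102, 1704, 0] ! i"
definition point_wt2 :: "nat \<Rightarrow> real" where
  "point_wt2 i = [0, 0, 3494, 1004, 700, 1233, 0, 0] ! i"
definition point_wt3 :: "nat \<Rightarrow> real" where
  "point_wt3 i = [0, 6819, 2961, 394, -266, -1099, -1343, 0] ! i"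
definition line_wt1 :: "nat \<Rightarrow> real" where
  "line_wt1 i = [0, 0, 6604, 2789, 1395, 818, 0, 0] ! i"
definition line_wt2 :: "nat \<Rightarrow> real" where
  "line_wt2 i = [0, 0, 2900, -1217, 607, -369, 0, 0] ! i"

text \<open>Each summand is a rank-one product of weights times a Gram entry, so positivity holds
  for any weights; their values matter only for the numerical inequalities. The line weights vanish
  in dimensions 0, 1, 6 and 7, where \<open>ln_fun\<close> is itself zero on
  \<open>frames\<close>.\<close>

definition cert_ker :: "nat \<Rightarrow> nat \<Rightarrow> nat \<Rightarrow> real" where
  "cert_ker i j d = const_wt i * const_wt j
    + (point_wt1 i * point_wt1 j + point_wt2 i * point_wt2 j + point_wt3 i * point_wt3 j)
      * point_ker i j d
    + (line_wt1 i * line_wt1 j + line_wt2 i * line_wt2 j) * line_ker i j d"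

lemmas cert_ker_defs = cert_ker_def point_ker_def line_ker_def const_wt_def
  point_wt1_def point_wt2_def point_wt3_def line_wt1_def line_wt2_def

text \<open>Weights scaled by 1000 scale the kernel by 1000000. Staying strictly below 388 in the
  original scale is what excludes a code of size 389.\<close>

lemma cert_ker_diag: "i \<le> 7 \<Longrightarrow> cert_ker i i i \<le> 387999999"
proof -
  assume "i \<le> 7"
  then have "i \<in> {0,1,2,3,4,5,6,7}" by auto
  then show ?thesis
    by (elim insertE emptyE; simp add: cert_ker_defs)
qed

lemma cert_ker_off_ordered:
  assumes "j \<le> 7" "d \<le> i" "i \<le> j" "i + j \<le> 7 + d" "4 + 2 * d \<le> i + j"
  shows "cert_ker i j d \<le> - 1000000"
proof -
  \<comment> \<open>Truncated subtraction makes \<open>i+j-7\<close> the larger of 0 and the bound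
    forced by the ambient dimension 7, leaving finitely many triples to evaluate.\<close>
  have "\<forall>i\<in>set [0..<8]. \<forall>j\<in>set [i..<8]. \<forall>d\<in>set [i+j-7..<Suc i].
      4 + 2 * d \<le> i + j \<longrightarrow> cert_ker i j d \<le> - 1000000"
    by (simp add: upt_rec) (simp add: cert_ker_defs)
  moreover have "i \<in> set [0..<8]" "j \<in> set [i..<8]" "d \<in> set [i+j-7..<Suc i]"
    using assms by auto
  ultimately show ?thesis
    using assms by blast
qed

lemma cert_ker_off:
  assumes "i \<le> 7" "j \<le> 7" "d \<le> i" "d \<le> j" "i + j \<le> 7 + d" "4 + 2 * d \<le> i + j"
  shows "cert_ker i j d \<le> - 1000000"
proof (cases "i \<le> j")
  case True
  then show ?thesis
    using assms by (simp add: cert_ker_off_ordered)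
next
  case False
  then have "cert_ker j i d \<le> - 1000000"
    using assms by (intro cert_ker_off_ordered) auto
  then show ?thesis
    by (simp add: cert_ker_def point_ker_sym[of i j] line_ker_sym[of i j] mult.commute)
qed

section \<open>From the certificate to the bound on codes\<close>

lemma min_distance_le:
  assumes "U \<in> C" "W \<in> C" "U \<noteq> W"
  shows "min_distance C \<le> enat (subspace_dist U W)"
  unfolding min_distance_def by (rule Inf_lower) (use assms in blast)

text \<open>Identifies the numerical kernel with actual Gram sums, to which
  \<open>gram_nonneg\<close> applies.\<close>

lemma cert_ker_subspaces:
  fixes U W :: "(bit ^ 7) set"
  assumes U: "vec.subspace U" and W: "vec.subspace W"
  shows "cert_ker (vec.dim U) (vec.dim W) (vec.dim (U \<inter> W)) = const_wt (vec.dim U) * const_wt (vec.dim W)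
    + (point_wt1 (vec.dim U) * point_wt1 (vec.dim W) + point_wt2 (vec.dim U) * point_wt2 (vec.dim W)
      + point_wt3 (vec.dim U) * point_wt3 (vec.dim W))
      * (\<Sum>v\<in>-{0}. pt_fun U v * pt_fun W v)
    + (line_wt1 (vec.dim U) * line_wt1 (vec.dim W) + line_wt2 (vec.dim U) * line_wt2 (vec.dim W))
      * (\<Sum>(v,w)\<in>frames. ln_fun U v w * ln_fun W v w)"
proof -
  have N: "npts (UNIV :: (bit ^ 7) set) = 127"
    by (simp only: npts_subspace[OF vec.subspace_UNIV] vec_dim_card) simp
  have m: "npts U = 2 ^ vec.dim U - 1" "npts W = 2 ^ vec.dim W - 1"
      "npts (U \<inter> W) = 2 ^ vec.dim (U \<inter> W) - 1"
    using U W by (simp_all add: npts_subspace vec.subspace_inter)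
  have "(\<Sum>v\<in>-{0}. pt_fun U v * pt_fun W v) = point_ker (vec.dim U) (vec.dim W) (vec.dim (U \<inter> W))"
    by (simp add: point_kernel N m point_ker_def)
  moreover have "(\<Sum>(v,w)\<in>frames. ln_fun U v w * ln_fun W v w)
      = line_ker (vec.dim U) (vec.dim W) (vec.dim (U \<inter> W))"
    using N by (simp add: line_kernel[OF U W] m line_ker_def ln_slope_def mult_ac)
      (simp add: algebra_simps)
  ultimately show ?thesis
    by (simp add: cert_ker_def)
qed

lemma sum_cert_ker_nonneg:
  fixes C :: "(bit ^ 7) set set"
  assumes "\<And>U. U \<in> C \<Longrightarrow> vec.subspace U"
  shows "(\<Sum>U\<in>C. \<Sum>W\<in>C. cert_ker (vec.dim U) (vec.dim W) (vec.dim (U \<inter> W))) \<ge> 0"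
proof -
  let ?s = "\<lambda>c g. \<Sum>U\<in>C. \<Sum>W\<in>C. c (vec.dim U) * c (vec.dim W) * g U W"
  let ?P = "\<lambda>U W :: (bit ^ 7) set. \<Sum>v\<in>-{0}. pt_fun U v * pt_fun W v"
  let ?L = "\<lambda>U W :: (bit ^ 7) set. \<Sum>(v,w)\<in>frames. ln_fun U v w * ln_fun W v w"
  \<comment> \<open>The constant kernel is the Gram matrix of the function 1 on a one-element index
    set.\<close>
  have const: "?s const_wt (\<lambda>U W. 1) \<ge> 0"
    using gram_nonneg[where h = "\<lambda>U s. 1" and S = "{()}" and c = "\<lambda>U. const_wt (vec.dim U)" and C = C]
    by simp
  have points: "?s c ?P \<ge> 0" for c
    by (rule gram_nonneg)
  have lines: "?s c ?L \<ge> 0" for c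
    using gram_nonneg[where h = "\<lambda>U (v, w). ln_fun U v w" and S = frames
        and c = "\<lambda>U. c (vec.dim U)" and C = C]
    by (simp add: case_prod_unfold)
  have "(\<Sum>U\<in>C. \<Sum>W\<in>C. cert_ker (vec.dim U) (vec.dim W) (vec.dim (U \<inter> W)))
      = ?s const_wt (\<lambda>U W. 1) + (?s point_wt1 ?P + ?s point_wt2 ?P + ?s point_wt3 ?P)
        + (?s line_wt1 ?L + ?s line_wt2 ?L)"
    using assms by (simp add: cert_ker_subspaces distrib_right flip: sum.distrib)
  also have "\<dots> \<ge> 0"
    by (intro add_nonneg_nonneg const points lines)
  finally show ?thesis .
qed

lemma card_code_le:
  fixes C :: "(bit ^ 7) set set"
  assumes C: "subspace_code C" and d: "enat 4 \<le> min_distance C"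
  shows "card C \<le> 388"
proof (cases "C = {}")
  case False
  have sub: "vec.subspace U" if "U \<in> C" for U
    using C that by (auto simp: subspace_code_def)
  let ?F = "\<lambda>U W. cert_ker (vec.dim U) (vec.dim W) (vec.dim (U \<inter> W))"
  let ?n = "real (card C)"
  have dim7: "vec.dim U \<le> 7" for U :: "(bit ^ 7) set"
    using vec.dim_subset[OF subset_UNIV, of U] by (simp only: vec_dim_card) simp
  have "?F U W \<le> (if U = W then 387999999 else - 1000000)" if "U \<in> C" "W \<in> C" for U W
  proof (cases "U = W")
    case True
    then show ?thesis
      using cert_ker_diag[OF dim7] by simp
  next
    case False
    have "4 \<le> subspace_dist U W"
      using order_trans[OF d min_distance_le[OF that False]] by simp
    \<comment> \<open>The dimension formula turns the distance into
      \<open>dim U + dim W - 2 * dim (U \<inter> W)\<close>; the second inequality says that the sum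
      of \<open>U\<close> and \<open>W\<close> has dimension at most 7.\<close>
    then have "4 + 2 * vec.dim (U \<inter> W) \<le> vec.dim U + vec.dim W"
        and "vec.dim U + vec.dim W \<le> 7 + vec.dim (U \<inter> W)"
      using vec.dim_sums_Int[OF sub sub, OF that] dim7[of "{x + y |x y. x \<in> U \<and> y \<in> W}"]
      unfolding subspace_dist_def by linarith+
    moreover have "vec.dim (U \<inter> W) \<le> vec.dim U" "vec.dim (U \<inter> W) \<le> vec.dim W"
      by (simp_all add: vec.dim_subset)
    ultimately show ?thesis
      using False by (simp add: cert_ker_off dim7)
  qed
  then have "(\<Sum>U\<in>C. \<Sum>W\<in>C. ?F U W) \<le> (\<Sum>U\<in>C. \<Sum>W\<in>C. if U = W then 387999999 else - 1000000)"
    by (intro sum_mono)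
  \<comment> \<open>Charging -1000000 to every pair raises the diagonal value by 1000000 to
    388999999.\<close>
  also have "\<dots> = (\<Sum>U\<in>C. \<Sum>W\<in>C. (if U = W then 388999999 else 0) - 1000000)"
    by (intro sum.cong refl) auto
  also have "\<dots> = ?n * (388999999 - 1000000 * ?n)"
    by (simp add: sum_subtractf sum.delta algebra_simps)
  finally have "0 \<le> ?n * (388999999 - 1000000 * ?n)"
    using sum_cert_ker_nonneg[of C] sub by (meson order_trans)
  moreover have "?n > 0"
    using False by (simp add: card_gt_0_iff)
  \<comment> \<open>Dividing by \<open>?n\<close> gives at most 388.999999, and integrality then
    gives 388.\<close>
  ultimately have "1000000 * ?n \<le> 388999999"
    by (auto simp: zero_le_mult_iff)
  then show ?thesis
    by linarith
qed simp

theorem theorem1: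
  shows "max_code_size TYPE(bit) TYPE(7) 4 \<le> 388"
  by (simp add: max_code_size_le_iff card_code_le)

end
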